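(* For every constant $0\le p<1$, the expected number $R_n(p)$ of occupied seats when the process ends, in a row of $n$ seats with a single entrance filled by $p$-courteous theatregoers choosing seats according to the right-biased Zipf distribution (model described in the context), satisfies $$R_n(p)=\Omega\!\left(\frac{H_n^2}{1-0.944p}\right)\quad\text{and}\quad R_n(p)=O\!\left(\frac{H_n^2}{1-p}\right)$$ as $n\to\infty$, where $H_n=\sum_{i=1}^n\frac1i$.
   Context: Row model: a row of $n$ seats with a single entrance at one end. Theatregoers arrive one at a time; each is, independently, courteous with probability $p$ and selfish with probability $1-p$, and this status never changes. A seated selfish theatregoer never gets up, so no later theatregoer can walk past her seat; a seated courteous theatregoer never blocks. An empty seat is accessible if it can be reached from the entrance without passing a seat occupied by a selfish theatregoer. When there are $m\ge1$ accessible empty seats, labelled $1,\dots,m$ in increasing order of distance from the entrance, the arriving theatregoer sits in the $k$-th one with probability $\frac{1}{(m+1-k)H_m}$ (right-biased Zipf distribution). The process ends when no accessible empty seat remains. *)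

theory Defs
  imports "HOL-Probability.Probability" "HOL-Analysis.Harmonic_Numbers"
    "HOL-Library.Landau_Symbols"
begin

text \<open>Seats are numbered \<open>1..n\<close>, seat 1 being the one next to the entrance. A
  configuration maps an occupied seat to the status of its occupant and an empty seat to \<open>None\<close>.\<close>

datatype status = Courteous | Selfish

type_synonym config = "nat \<Rightarrow> status option"

definition accessible :: "nat \<Rightarrow> config \<Rightarrow> nat set" where
  "accessible n s = {i \<in> {1..n}. s i = None \<and> (\<forall>j \<in> {1..<i}. s j \<noteq> Some Selfish)}"

text \<open>The right-biased Zipf distribution is meaningful for \<open>m \<ge> 1\<close>; see \<open>pmf_right_zipf\<close> below.\<close>

definition right_zipf :: "nat \<Rightarrow> nat pmf" where
  "right_zipf m =
     embed_pmf (\<lambda>k. if k \<in> {1..m} then 1 / (real (m + 1 - k) * harm m) else 0)"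

definition status_pmf :: "real \<Rightarrow> status pmf" where
  "status_pmf p = map_pmf (\<lambda>c. if c then Courteous else Selfish) (bernoulli_pmf p)"

text \<open>One arrival. The status of a theatregoer is drawn when she arrives, independently of
  everything else. Configurations without accessible empty seats are absorbing.\<close>

definition arrival :: "nat \<Rightarrow> real \<Rightarrow> config \<Rightarrow> config pmf" where
  "arrival n p s =
     (if accessible n s = {} then return_pmf s
      else do {
        k \<leftarrow> right_zipf (card (accessible n s));
        c \<leftarrow> status_pmf p;
        return_pmf (s(sorted_list_of_set (accessible n s) ! (k - 1) \<mapsto> c))
      })"

primrec after_arrivals :: "nat \<Rightarrow> real \<Rightarrow> nat \<Rightarrow> config pmf" where
  "after_arrivals n p 0 = return_pmf Map.empty"
| "after_arrivals n p (Suc t) = bind_pmf (after_arrivals n p t) (arrival n p)"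

text \<open>Every non-trivial arrival fills a seat, so the process has ended after at most \<open>n\<close>
  arrivals; see \<open>final_config_no_accessible\<close> below.\<close>

definition final_config :: "nat \<Rightarrow> real \<Rightarrow> config pmf" where
  "final_config n p = after_arrivals n p n"

definition expected_occupied :: "nat \<Rightarrow> real \<Rightarrow> real" where
  "expected_occupied n p = measure_pmf.expectation (final_config n p) (\<lambda>s. real (card (dom s)))"

lemma pmf_right_zipf:
  assumes "m \<ge> 1"
  shows "pmf (right_zipf m) k = (if k \<in> {1..m} then 1 / (real (m + 1 - k) * harm m) else 0)"
proof -
  let ?f = "\<lambda>k. if k \<in> {1..m} then 1 / (real (m + 1 - k) * harm m) else 0 :: real"
  have pos: "harm m > (0::real)" using assms by (simp add: harm_pos)
  have nn: "?f k \<ge> 0" for k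
    using harm_nonneg[of m] by (auto simp del: of_nat_diff intro!: divide_nonneg_nonneg mult_nonneg_nonneg)
  have "(\<Sum>k=1..m. 1 / (real (m + 1 - k) * harm m)) = (\<Sum>k=1..m. 1 / (real k * harm m))"
    by (rule sum.reindex_bij_witness[of _ "\<lambda>k. m + 1 - k" "\<lambda>k. m + 1 - k"]) auto
  also have "\<dots> = (\<Sum>k=1..m. inverse (real k)) / harm m"
    by (simp add: sum_divide_distrib field_simps)
  also have "\<dots> = 1" using pos by (simp add: harm_def)
  finally have s: "(\<Sum>k=1..m. ?f k) = 1" by simp
  have "(\<integral>\<^sup>+k. ennreal (?f k) \<partial>count_space UNIV) = (\<Sum>k\<in>{1..m}. ennreal (?f k))"
    by (rule nn_integral_count_space'[of "{1..m}"]) auto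
  also have "\<dots> = ennreal (\<Sum>k=1..m. ?f k)" by (rule sum_ennreal) (rule nn)
  finally have "(\<integral>\<^sup>+k. ennreal (?f k) \<partial>count_space UNIV) = 1" using s by simp
  then show ?thesis unfolding right_zipf_def by (rule pmf_embed_pmf[OF nn])
qed

lemma after_arrivals_progress:
  assumes "s \<in> set_pmf (after_arrivals n p t)"
  shows "dom s \<subseteq> {1..n} \<and> (accessible n s = {} \<or> card (dom s) = t)"
  using assms
proof (induction t arbitrary: s)
  case 0
  then show ?case by simp
next
  case (Suc t)
  then obtain s' where s': "s' \<in> set_pmf (after_arrivals n p t)"
    and st: "s \<in> set_pmf (arrival n p s')" by auto
  note IH = Suc.IH[OF s']
  show ?case
  proof (cases "accessible n s' = {}")
    case True
    then show ?thesis using st IH by (simp add: arrival_def)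
  next
    case False
    let ?A = "accessible n s'"
    have fin: "finite ?A" by (simp add: accessible_def)
    then have m: "card ?A \<ge> 1" using False by (simp add: Suc_le_eq card_gt_0_iff)
    obtain k c where k: "k \<in> set_pmf (right_zipf (card ?A))"
      and s: "s = s'(sorted_list_of_set ?A ! (k - 1) \<mapsto> c)"
      using st False by (auto simp: arrival_def)
    have "k \<in> {1..card ?A}"
      using k pmf_right_zipf[OF m, of k] by (auto simp: set_pmf_eq split: if_splits)
    then have "k - 1 < length (sorted_list_of_set ?A)" by auto
    then have "sorted_list_of_set ?A ! (k - 1) \<in> set (sorted_list_of_set ?A)"
      by (rule nth_mem)
    then have "sorted_list_of_set ?A ! (k - 1) \<in> ?A" by (simp only: set_sorted_list_of_set[OF fin])
    then obtain a where a_def: "a = sorted_list_of_set ?A ! (k - 1)" and "a \<in> ?A" by blast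
    have an: "a \<in> {1..n} \<and> s' a = None"
      using \<open>a \<in> ?A\<close> unfolding accessible_def mem_Collect_eq by (elim conjE) (intro conjI)
    then have a: "a \<in> {1..n}" "a \<notin> dom s'" by (simp_all add: domIff)
    have "dom s = insert a (dom s')" unfolding s a_def[symmetric] by simp
    moreover have "finite (dom s')" using IH finite_subset by blast
    ultimately show ?thesis using a IH False by simp
  qed
qed

lemma final_config_no_accessible:
  assumes "s \<in> set_pmf (final_config n p)"
  shows "accessible n s = {}"
proof (rule ccontr)
  assume ne: "accessible n s \<noteq> {}"
  with assms after_arrivals_progress have "dom s \<subseteq> {1..n}" "card (dom s) = n"
    unfolding final_config_def by blast+
  then have "dom s = {1..n}" by (simp add: card_subset_eq)
  moreover obtain i where "i \<in> {1..n}" "s i = None" using ne by (auto simp: accessible_def)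
  ultimately show False by (metis domIff)
qed

end

theory Submission
  imports Defs
begin

text \<open>Only the number of accessible seats matters: from \<open>m\<close> of them, a courteous arrival leaves
  \<open>m - 1\<close> and a selfish arrival in the \<open>k\<close>-th one leaves \<open>k - 1\<close>. The resulting recursion for the
  expected number of further arrivals defines \<open>row_value\<close>, and the number of occupied seats plus
  the \<open>row_value\<close> of the number of accessible seats is a martingale.

  The recursion is solved up to constants by comparison with multiples of \<open>(harm m)\<^sup>2 / (1 - p)\<close>.
  Everything rests on the identity that the sum of \<open>(harm m - harm j) / (m - j)\<close> over \<open>j < m\<close> equals
  the sum of \<open>1 / i\<^sup>2\<close> over \<open>1 \<le> i \<le> m\<close>, which lies between 1 and 2. The courteous term
  contributes the increment of \<open>(harm m)\<^sup>2\<close>, which is positive and tends to 0, so it is harmless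
  for the upper bound and negligible, for fixed \<open>p\<close> and large \<open>m\<close>, in the lower bound. This gives
  the order \<open>(harm n)\<^sup>2 / (1 - p)\<close> on both sides, which is stronger than the stated lower bound.\<close>

section \<open>Averages under the right-biased Zipf distribution\<close>

text \<open>The row has \<open>Suc m\<close> accessible seats, and \<open>j = k - 1\<close> counts
  those nearer to the entrance than the chosen one. The shift keeps the distribution meaningful for
  every \<open>m\<close>, and \<open>j\<close> is exactly what remains after a selfish
  arrival.\<close>

definition zipf_mean :: "nat \<Rightarrow> (nat \<Rightarrow> real) \<Rightarrow> real" where
  "zipf_mean m f = (\<Sum>j\<le>m. f j / (real (Suc m - j) * harm (Suc m)))"

lemma set_right_zipf_subset: "set_pmf (right_zipf (Suc m)) \<subseteq> {1..Suc m}"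
  using pmf_right_zipf[of "Suc m"] by (auto simp: set_pmf_eq split: if_splits)

lemma expectation_right_zipf:
  "measure_pmf.expectation (right_zipf (Suc m)) (\<lambda>k. f (k - 1)) = zipf_mean m f"
proof -
  have "measure_pmf.expectation (right_zipf (Suc m)) (\<lambda>k. f (k - 1)) =
      (\<Sum>k\<in>{1..Suc m}. pmf (right_zipf (Suc m)) k *\<^sub>R f (k - 1))"
    by (rule integral_measure_pmf) (use set_right_zipf_subset[of m] in auto)
  also have "\<dots> = (\<Sum>k\<in>{1..Suc m}. f (k - 1) / (real (Suc m + 1 - k) * harm (Suc m)))"
    by (intro sum.cong) (simp_all add: pmf_right_zipf)
  also have "\<dots> = zipf_mean m f"
    unfolding zipf_mean_def
    by (rule sum.reindex_bij_witness[of _ Suc "\<lambda>k. k - 1"]) auto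
  finally show ?thesis .
qed

lemma zipf_mean_const: "zipf_mean m (\<lambda>_. c) = c"
  using expectation_right_zipf[of m "\<lambda>_. c"] by simp

lemma zipf_mean_mono:
  assumes "\<And>j. j \<le> m \<Longrightarrow> f j \<le> g j"
  shows "zipf_mean m f \<le> zipf_mean m g"
  unfolding zipf_mean_def
  by (intro sum_mono divide_right_mono) (use assms in \<open>auto intro!: mult_nonneg_nonneg harm_nonneg\<close>)

lemma zipf_mean_diff: "zipf_mean m (\<lambda>j. f j - g j) = zipf_mean m f - zipf_mean m g"
  by (simp add: zipf_mean_def diff_divide_distrib sum_subtractf)

lemma zipf_mean_add: "zipf_mean m (\<lambda>j. f j + g j) = zipf_mean m f + zipf_mean m g"
  by (simp add: zipf_mean_def add_divide_distrib sum.distrib)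

lemma zipf_mean_cmult: "zipf_mean m (\<lambda>j. c * f j) = c * zipf_mean m f"
  by (simp add: zipf_mean_def sum_distrib_left)

text \<open>As a congruence rule for \<open>fun\<close>, this shows the termination prover that
  \<open>row_value\<close> at \<open>Suc m\<close> is called under the average only at arguments
  \<open>j \<le> m\<close>.\<close>

lemma zipf_mean_cong [fundef_cong]:
  assumes "m = m'" "\<And>j. j \<le> m' \<Longrightarrow> f j = g j"
  shows "zipf_mean m f = zipf_mean m' g"
  using assms by (auto simp: zipf_mean_def intro!: sum.cong)

section \<open>Reduction of the seating process to a recursion\<close>

fun row_value :: "real \<Rightarrow> nat \<Rightarrow> real" where
  "row_value p 0 = 0"
| "row_value p (Suc m) = 1 + p * row_value p m + (1 - p) * zipf_mean m (\<lambda>j. row_value p j)"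

lemma accessible_courteous:
  assumes "a \<in> accessible n s"
  shows "accessible n (s(a \<mapsto> Courteous)) = accessible n s - {a}"
  using assms by (auto simp: accessible_def)

text \<open>Seats behind \<open>a\<close> are now blocked, while the accessibility of a nearer seat
  depends only on itself and seats still nearer, all unchanged.\<close>

lemma accessible_selfish:
  assumes "a \<in> accessible n s"
  shows "accessible n (s(a \<mapsto> Selfish)) = {x \<in> accessible n s. x < a}"
proof (intro equalityI subsetI)
  fix x assume x: "x \<in> accessible n (s(a \<mapsto> Selfish))"
  have a1: "1 \<le> a" using assms by (simp add: accessible_def)
  have ne: "x \<noteq> a" using x by (auto simp: accessible_def)
  have "\<not> a < x"
  proof
    assume "a < x"
    then have "a \<in> {1..<x}" using a1 by simp
    then show False using x unfolding accessible_def by fastforce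
  qed
  with ne have "x < a" by simp
  moreover from x ne have "x \<in> accessible n s"
    using assms by (auto simp: accessible_def split: if_splits)
  ultimately show "x \<in> {x \<in> accessible n s. x < a}" by simp
next
  fix x assume "x \<in> {x \<in> accessible n s. x < a}"
  then show "x \<in> accessible n (s(a \<mapsto> Selfish))" by (auto simp: accessible_def)
qed

text \<open>The list is strictly increasing, so comparing entries is comparing indices. With
  \<open>accessible_selfish\<close> this counts the seats left accessible by a selfish
  arrival.\<close>

lemma card_less_nth_sorted_list_of_set:
  fixes A :: "nat set"
  assumes "finite A" "i < card A"
  shows "card {x \<in> A. x < sorted_list_of_set A ! i} = i"
proof -
  let ?l = "sorted_list_of_set A"
  have len: "length ?l = card A" by simp
  have sorted: "sorted_wrt (<) ?l" by simp
  have lt: "?l ! j < ?l ! i \<longleftrightarrow> j < i" if "j < card A" for j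
    using sorted_wrt_nth_less[OF sorted, of j i] sorted_wrt_nth_less[OF sorted, of i j] that assms len
    by (metis linorder_neqE_nat order.asym order.irrefl)
  have "{x \<in> A. x < ?l ! i} = (!) ?l ` {..<i}"
  proof (intro equalityI subsetI)
    fix x assume x: "x \<in> {x \<in> A. x < ?l ! i}"
    then have "x \<in> set ?l" using assms(1) by simp
    then obtain j where "j < card A" "x = ?l ! j" by (metis in_set_conv_nth len)
    then show "x \<in> (!) ?l ` {..<i}" using x lt by auto
  next
    fix x assume "x \<in> (!) ?l ` {..<i}"
    then obtain j where j: "j < i" "x = ?l ! j" by auto
    then have "x \<in> set ?l" using assms(2) len by (metis nth_mem order.strict_trans)
    then have "x \<in> A" using assms(1) by simp
    then show "x \<in> {x \<in> A. x < ?l ! i}" using j lt[of j] assms(2) by auto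
  qed
  moreover have "inj_on ((!) ?l) {..<i}"
    by (rule inj_on_nth) (use assms in auto)
  ultimately show ?thesis by (simp add: card_image)
qed

lemma expectation_status_pmf:
  assumes "0 \<le> p" "p \<le> 1"
  shows "measure_pmf.expectation (status_pmf p) (h :: status \<Rightarrow> real) =
    p * h Courteous + (1 - p) * h Selfish"
  using assms by (simp add: status_pmf_def integral_bernoulli_pmf mult.commute)

lemma finite_set_status_pmf: "finite (set_pmf (status_pmf p))"
  by (simp add: status_pmf_def)

lemma finite_set_right_zipf: "finite (set_pmf (right_zipf (Suc m)))"
  by (rule finite_subset[OF set_right_zipf_subset]) simp

lemma finite_accessible: "finite (accessible n s)"
  by (simp add: accessible_def)

text \<open>Finite supports allow the expectation over a bind to be expanded as a finite sum, with
  no integrability to check.\<close>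

lemma finite_set_arrival: "finite (set_pmf (arrival n p s))"
proof (cases "card (accessible n s)")
  case 0
  then show ?thesis by (simp add: finite_accessible arrival_def)
next
  case (Suc m)
  then show ?thesis
    by (auto simp: arrival_def finite_set_right_zipf finite_set_status_pmf)
qed

lemma finite_set_after_arrivals: "finite (set_pmf (after_arrivals n p t))"
  by (induction t) (simp_all add: finite_set_arrival)

definition potential :: "nat \<Rightarrow> real \<Rightarrow> config \<Rightarrow> real" where
  "potential n p s = real (card (dom s)) + row_value p (card (accessible n s))"

text \<open>An effective arrival adds one occupant, which is the summand 1 in the recursion; the
  other two summands average \<open>row_value\<close> over the seats left. Hence the mean is
  preserved. Without accessible seats nothing changes.\<close>

lemma expectation_potential_arrival:
  assumes p: "0 \<le> p" "p \<le> 1" and dom: "finite (dom s)"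
  shows "measure_pmf.expectation (arrival n p s) (potential n p) = potential n p s"
proof (cases "card (accessible n s)")
  case 0
  then show ?thesis by (simp add: finite_accessible arrival_def)
next
  case (Suc m)
  let ?A = "accessible n s"
  define seat where "seat k = sorted_list_of_set ?A ! (k - 1)" for k
  have ne: "?A \<noteq> {}" using Suc by auto
  have arr: "arrival n p s =
      right_zipf (Suc m) \<bind> (\<lambda>k. map_pmf (\<lambda>c. s(seat k \<mapsto> c)) (status_pmf p))"
    using ne by (simp add: arrival_def Suc seat_def map_pmf_def)
  \<comment> \<open>\<open>?g (k - 1)\<close> is the mean potential after an arrival in the
    \<open>k\<close>-th accessible seat, averaged over her status.\<close>
  let ?g = "\<lambda>j. (real (card (dom s)) + 1 + p * row_value p m) + (1 - p) * row_value p j"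
  have inner: "measure_pmf.expectation (map_pmf (\<lambda>c. s(seat k \<mapsto> c)) (status_pmf p)) (potential n p)
      = ?g (k - 1)" if "k \<in> {1..Suc m}" for k
  proof -
    have k: "k - 1 < card ?A" using that Suc by auto
    then have "seat k \<in> set (sorted_list_of_set ?A)" unfolding seat_def by (intro nth_mem) simp
    then have a: "seat k \<in> ?A" by (simp add: finite_accessible)
    then have "seat k \<notin> dom s" by (simp add: accessible_def domIff)
    then have d: "card (dom (s(seat k \<mapsto> c))) = Suc (card (dom s))" for c
      using dom by simp
    have "card {x \<in> ?A. x < seat k} = k - 1"
      unfolding seat_def by (rule card_less_nth_sorted_list_of_set[OF finite_accessible k])
    then have "potential n p (s(seat k \<mapsto> Selfish)) = real (card (dom s)) + 1 + row_value p (k - 1)"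
      unfolding potential_def d accessible_selfish[OF a] by simp
    moreover have "potential n p (s(seat k \<mapsto> Courteous)) = real (card (dom s)) + 1 + row_value p m"
      unfolding potential_def d accessible_courteous[OF a] using a Suc by (simp add: finite_accessible)
    ultimately show ?thesis
      by (simp add: expectation_status_pmf[OF p] algebra_simps)
  qed
  have "measure_pmf.expectation (arrival n p s) (potential n p) =
      (\<Sum>k\<in>{1..Suc m}. pmf (right_zipf (Suc m)) k *\<^sub>R
        measure_pmf.expectation (map_pmf (\<lambda>c. s(seat k \<mapsto> c)) (status_pmf p)) (potential n p))"
    unfolding arr by (rule pmf_expectation_bind) (use set_right_zipf_subset[of m] finite_set_status_pmf in auto)
  also have "\<dots> = (\<Sum>k\<in>{1..Suc m}. pmf (right_zipf (Suc m)) k *\<^sub>R ?g (k - 1))"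
    by (intro sum.cong refl) (simp only: inner)
  also have "\<dots> = measure_pmf.expectation (right_zipf (Suc m)) (\<lambda>k. ?g (k - 1))"
    by (rule integral_measure_pmf[symmetric]) (use set_right_zipf_subset[of m] in auto)
  also have "\<dots> = zipf_mean m ?g" by (rule expectation_right_zipf)
  also have "\<dots> = potential n p s"
    by (simp add: zipf_mean_add zipf_mean_const zipf_mean_cmult potential_def Suc)
  finally show ?thesis .
qed

lemma expectation_potential_after_arrivals:
  assumes p: "0 \<le> p" "p \<le> 1"
  shows "measure_pmf.expectation (after_arrivals n p t) (potential n p) = row_value p n"
proof (induction t)
  case 0
  have "accessible n Map.empty = {1..n}" by (auto simp: accessible_def)
  then show ?case by (simp add: potential_def)
next
  case (Suc t)
  let ?S = "set_pmf (after_arrivals n p t)"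
  have "measure_pmf.expectation (after_arrivals n p (Suc t)) (potential n p) =
      (\<Sum>s\<in>?S. pmf (after_arrivals n p t) s *\<^sub>R
        measure_pmf.expectation (arrival n p s) (potential n p))"
    unfolding after_arrivals.simps
    by (rule pmf_expectation_bind) (auto simp: finite_set_after_arrivals finite_set_arrival)
  also have "\<dots> = (\<Sum>s\<in>?S. pmf (after_arrivals n p t) s *\<^sub>R potential n p s)"
  proof (intro sum.cong refl)
    fix s assume "s \<in> ?S"
    then have "dom s \<subseteq> {1..n}" using after_arrivals_progress by blast
    then have "finite (dom s)" by (rule finite_subset) simp
    from expectation_potential_arrival[OF p this] show "pmf (after_arrivals n p t) s *\<^sub>R
        measure_pmf.expectation (arrival n p s) (potential n p) =
        pmf (after_arrivals n p t) s *\<^sub>R potential n p s"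
      by (simp only:)
  qed
  also have "\<dots> = measure_pmf.expectation (after_arrivals n p t) (potential n p)"
    by (rule integral_measure_pmf[symmetric]) (auto simp: finite_set_after_arrivals)
  finally show ?case using Suc by simp
qed

text \<open>At the end no seat is accessible and \<open>row_value p 0 = 0\<close>, so the potential
  is then the number of occupied seats; its mean is still the initial value.\<close>

lemma expected_occupied_eq_row_value:
  assumes "0 \<le> p" "p \<le> 1"
  shows "expected_occupied n p = row_value p n"
proof -
  have "expected_occupied n p = measure_pmf.expectation (final_config n p) (potential n p)"
    unfolding expected_occupied_def
    by (intro integral_cong_AE)
      (auto simp: AE_measure_pmf_iff potential_def dest!: final_config_no_accessible)
  then show ?thesis
    using expectation_potential_after_arrivals[OF assms] by (simp add: final_config_def)
qed

section \<open>Harmonic number estimates\<close>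

lemma sum_harm_diff_Suc:
  "(\<Sum>j\<le>Suc m. (harm (Suc (Suc m)) - harm j) / real (Suc (Suc m) - j)) =
   (\<Sum>j\<le>m. (harm (Suc m) - harm j) / real (Suc m - j)) + 1 / (real m + 2)\<^sup>2"
proof -
  let ?H = "harm :: nat \<Rightarrow> real"
  have "(\<Sum>j\<le>Suc m. (?H (Suc (Suc m)) - ?H j) / real (Suc (Suc m) - j)) =
      ?H (Suc (Suc m)) / (real m + 2) + (\<Sum>j\<le>m. (?H (Suc (Suc m)) - ?H (Suc j)) / real (Suc m - j))"
    \<comment> \<open>The term for \<open>j = 0\<close> is split off, using
      \<open>harm 0 = 0\<close>; the shift gives the remaining terms the denominators of the shorter
      sum.\<close>
    by (subst sum.atMost_Suc_shift) (simp add: harm_expand add.commute)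
  also have "(\<Sum>j\<le>m. (?H (Suc (Suc m)) - ?H (Suc j)) / real (Suc m - j)) =
      (\<Sum>j\<le>m. (?H (Suc m) - ?H j) / real (Suc m - j) - (1 / (real m + 2)) * inverse (real (Suc j)))"
  proof (intro sum.cong refl)
    fix j assume "j \<in> {..m}"
    then have j: "real (Suc m - j) = real m + 1 - real j" "real m + 1 - real j > 0" by auto
    have "?H (Suc (Suc m)) = ?H (Suc m) + 1 / (real m + 2)" "?H (Suc j) = ?H j + 1 / (real j + 1)"
      by (simp_all add: harm_Suc inverse_eq_divide add.commute)
    then have "?H (Suc (Suc m)) - ?H (Suc j) =
        (?H (Suc m) - ?H j) + (1 / (real m + 2) - 1 / (real j + 1))" by simp
    \<comment> \<open>The factor \<open>real m + 1 - real j\<close> cancels the denominator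
      \<open>real (Suc m - j)\<close>, so the corrections add up to a multiple of
      \<open>harm (Suc m)\<close>.\<close>
    also have "1 / (real m + 2) - 1 / (real j + 1) =
        - ((real m + 1 - real j) * (1 / (real m + 2) * inverse (real (Suc j))))"
      by (simp add: divide_simps) (simp add: algebra_simps)
    finally show "(?H (Suc (Suc m)) - ?H (Suc j)) / real (Suc m - j) =
      (?H (Suc m) - ?H j) / real (Suc m - j) - (1 / (real m + 2)) * inverse (real (Suc j))"
      using j by (simp only: add_uminus_conv_diff diff_divide_distrib
          nonzero_mult_div_cancel_left less_imp_neq[symmetric] not_False_eq_True)
  qed
  also have "\<dots> = (\<Sum>j\<le>m. (?H (Suc m) - ?H j) / real (Suc m - j)) - ?H (Suc m) / (real m + 2)"
  proof -
    have "?H (Suc m) = (\<Sum>j\<le>m. inverse (real (Suc j)))"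
      unfolding harm_def by (rule sum.reindex_bij_witness[of _ Suc "\<lambda>k. k - 1"]) auto
    then show ?thesis
      by (simp only: sum_subtractf sum_divide_distrib times_divide_eq_left mult_1)
  qed
  finally have "(\<Sum>j\<le>Suc m. (?H (Suc (Suc m)) - ?H j) / real (Suc (Suc m) - j)) =
      ?H (Suc (Suc m)) / (real m + 2) +
      ((\<Sum>j\<le>m. (?H (Suc m) - ?H j) / real (Suc m - j)) - ?H (Suc m) / (real m + 2))" .
  moreover have "?H (Suc (Suc m)) / (real m + 2) = ?H (Suc m) / (real m + 2) + 1 / (real m + 2)\<^sup>2"
    by (simp add: harm_Suc inverse_eq_divide add_divide_distrib power2_eq_square add.commute)
  ultimately show ?thesis by (simp only:)
qed

text \<open>The increments \<open>1 / (real m + 2)\<^sup>2\<close> are nonnegative and at most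
  \<open>1 / (real m + 1) - 1 / (real m + 2)\<close>. The subtracted term in the upper bound lets
  the induction telescope.\<close>

lemma sum_harm_diff_bounds:
  "1 \<le> (\<Sum>j\<le>m. (harm (Suc m) - harm j) / real (Suc m - j))"
  "(\<Sum>j\<le>m. (harm (Suc m) - harm j) / real (Suc m - j)) \<le> 2 - 1 / (real m + 1)"
proof (induction m)
  case 0
  { case 1 then show ?case by (simp add: harm_expand) }
  { case 2 then show ?case by (simp add: harm_expand) }
next
  case (Suc m)
  { case 1 show ?case unfolding sum_harm_diff_Suc using Suc.IH(1) by (simp add: add_increasing2) }
  { case 2
    have "1 / (real m + 2)\<^sup>2 \<le> 1 / ((real m + 1) * (real m + 2))"
      by (intro divide_left_mono) (auto simp: power2_eq_square intro!: mult_right_mono)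
    also have "\<dots> = 1 / (real m + 1) - 1 / (real m + 2)" by (simp add: field_simps)
    finally show ?case unfolding sum_harm_diff_Suc using Suc.IH(2) by (simp add: add.commute) }
qed

text \<open>Factoring each difference of squares and dividing by the normalization
  \<open>harm (Suc m)\<close> gives the terms of the previous sum times
  \<open>(?H + harm j) / ?H\<close>, a factor between 1 and 2.\<close>

lemma harm_square_minus_zipf_mean:
  "1 \<le> (harm (Suc m))\<^sup>2 - zipf_mean m (\<lambda>j. (harm j)\<^sup>2)"
  "(harm (Suc m))\<^sup>2 - zipf_mean m (\<lambda>j. (harm j)\<^sup>2) \<le> 4"
proof -
  let ?H = "harm (Suc m) :: real"
  have pos: "?H > 0" by (simp add: harm_pos)
  have eq: "?H\<^sup>2 - zipf_mean m (\<lambda>j. (harm j)\<^sup>2) =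
      (\<Sum>j\<le>m. (?H - harm j) / real (Suc m - j) * ((?H + harm j) / ?H))"
  proof -
    have "?H\<^sup>2 - zipf_mean m (\<lambda>j. (harm j)\<^sup>2) = zipf_mean m (\<lambda>j. ?H\<^sup>2 - (harm j)\<^sup>2)"
      by (simp only: zipf_mean_diff zipf_mean_const)
    also have "\<dots> = (\<Sum>j\<le>m. (?H - harm j) / real (Suc m - j) * ((?H + harm j) / ?H))"
      unfolding zipf_mean_def
      by (intro sum.cong refl) (simp only: power2_eq_square square_diff_square_factored
          times_divide_times_eq mult.commute mult.left_commute)
    finally show ?thesis .
  qed
  have le: "harm j \<le> ?H" if "j \<le> m" for j using that by (intro harm_mono) simp
  have nn: "0 \<le> (?H - harm j) / real (Suc m - j)" if "j \<le> m" for j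
    using le[OF that] by (intro divide_nonneg_nonneg) auto
  have "(\<Sum>j\<le>m. (?H - harm j) / real (Suc m - j)) \<le>
      (\<Sum>j\<le>m. (?H - harm j) / real (Suc m - j) * ((?H + harm j) / ?H))"
  proof (intro sum_mono)
    fix j assume "j \<in> {..m}"
    then have "0 \<le> (?H - harm j) / real (Suc m - j)" using nn by simp
    moreover have "1 \<le> (?H + harm j) / ?H" using pos harm_nonneg[of j] by (simp add: le_divide_eq)
    ultimately show "(?H - harm j) / real (Suc m - j) \<le>
        (?H - harm j) / real (Suc m - j) * ((?H + harm j) / ?H)"
      by (metis mult_left_mono mult.right_neutral)
  qed
  then show "1 \<le> ?H\<^sup>2 - zipf_mean m (\<lambda>j. (harm j)\<^sup>2)"
    unfolding eq using sum_harm_diff_bounds(1)[of m] by linarith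
  have "(\<Sum>j\<le>m. (?H - harm j) / real (Suc m - j) * ((?H + harm j) / ?H)) \<le>
      (\<Sum>j\<le>m. (?H - harm j) / real (Suc m - j) * 2)"
  proof (intro sum_mono mult_left_mono)
    fix j assume "j \<in> {..m}"
    then show "(?H + harm j) / ?H \<le> 2" using le[of j] pos by (simp add: divide_le_eq)
  qed (simp add: nn del: of_nat_diff)
  also have "\<dots> = 2 * (\<Sum>j\<le>m. (?H - harm j) / real (Suc m - j))"
    by (simp add: sum_distrib_left mult.commute)
  also have "\<dots> \<le> 2 * 2"
    by (intro mult_left_mono order_trans[OF sum_harm_diff_bounds(2)]) simp_all
  finally show "?H\<^sup>2 - zipf_mean m (\<lambda>j. (harm j)\<^sup>2) \<le> 4" unfolding eq by simp
qed

section \<open>Upper and lower bounds for the recursion\<close>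

text \<open>With the factor \<open>1 / (1 - p)\<close>, the drop of at least 1 in the averaged
  square, weighted by the selfish probability \<open>1 - p\<close>, pays for the summand 1 of the
  recursion. The courteous term needs only monotonicity of \<open>harm\<close>.\<close>

lemma row_value_upper:
  assumes "0 \<le> p" "p < 1"
  shows "row_value p n \<le> (harm n)\<^sup>2 / (1 - p)"
proof (induction n rule: less_induct)
  case (less n)
  show ?case
  proof (cases n)
    case 0
    then show ?thesis using assms by simp
  next
    case (Suc m)
    let ?H = "\<lambda>n. (harm n)\<^sup>2 :: real"
    have "zipf_mean m (row_value p) \<le> zipf_mean m (\<lambda>j. 1 / (1 - p) * ?H j)"
      by (rule zipf_mean_mono) (use less Suc in auto)
    also have "\<dots> = 1 / (1 - p) * zipf_mean m ?H" by (rule zipf_mean_cmult)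
    also have "\<dots> \<le> 1 / (1 - p) * (?H (Suc m) - 1)"
      using harm_square_minus_zipf_mean(1)[of m] assms by (intro mult_left_mono) auto
    finally have "(1 - p) * zipf_mean m (row_value p) \<le> ?H (Suc m) - 1"
      using assms by (simp add: field_simps)
    moreover have "row_value p m \<le> ?H (Suc m) / (1 - p)"
    proof -
      have "?H m \<le> ?H (Suc m)" by (intro power_mono harm_mono harm_nonneg) simp
      then show ?thesis using less[of m] Suc assms
        by (meson divide_right_mono order_trans lessI less_imp_le diff_ge_0_iff_ge)
    qed
    then have "p * row_value p m \<le> p * (?H (Suc m) / (1 - p))"
      using assms by (intro mult_left_mono) auto
    ultimately have "row_value p n \<le> ?H (Suc m) + p * (?H (Suc m) / (1 - p))"
      by (simp add: Suc)
    also have "\<dots> = ?H (Suc m) / (1 - p)" using assms by (simp add: field_simps)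
    finally show ?thesis by (simp add: Suc)
  qed
qed

lemma row_value_nonneg:
  assumes "0 \<le> p" "p \<le> 1"
  shows "0 \<le> row_value p n"
proof (induction n rule: less_induct)
  case (less n)
  show ?case
  proof (cases n)
    case (Suc m)
    have "zipf_mean m (\<lambda>_. 0) \<le> zipf_mean m (row_value p)"
      by (rule zipf_mean_mono) (use less Suc in auto)
    then show ?thesis using less[of m] Suc assms by (simp add: zipf_mean_const)
  qed simp
qed

lemma harm_over_id_tendsto_0: "(\<lambda>n. harm n / real n :: real) \<longlonglongrightarrow> 0"
proof -
  have "(\<lambda>n. (harm n - ln (real n)) * (1 / real n) + ln (real n) / real n) \<longlonglongrightarrow> euler_mascheroni * 0 + 0"
    by (intro tendsto_intros euler_mascheroni_LIMSEQ lim_1_over_n lim_ln_over_n)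
  then show ?thesis by (simp add: diff_divide_distrib)
qed

text \<open>Subtracting a constant does not affect the recursive inequality and makes the bound trivial
  for the small \<open>n\<close> at which the increment of \<open>(harm n)\<^sup>2\<close> is still too large.\<close>

lemma row_value_lower:
  assumes p: "0 \<le> p" "p < 1"
  obtains D where "\<And>n. (harm n)\<^sup>2 / (8 * (1 - p)) - D \<le> row_value p n"
proof -
  let ?H = "\<lambda>n. (harm n)\<^sup>2 :: real"
  \<comment> \<open>The summand 1 of the recursion is split in halves. With this \<open>a\<close>,
    the selfish loss \<open>(1 - p) * (4 * a)\<close> is one half, and so is the bound
    \<open>a * (4 * (1 - p))\<close> on the courteous loss.\<close>
  define a where "a = 1 / (8 * (1 - p))"
  have a: "a > 0" "(1 - p) * a = 1 / 8" using p by (simp_all add: a_def field_simps)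
  \<comment> \<open>The increment of \<open>(harm n)\<^sup>2\<close> is at most
    \<open>2 * harm n / real n\<close>, hence at most \<open>4 * (1 - p)\<close> from
    \<open>M\<close> on.\<close>
  have "eventually (\<lambda>n. harm n / real n < 2 * (1 - p)) sequentially"
    using p by (intro order_tendstoD[OF harm_over_id_tendsto_0]) simp
  then obtain M where M: "\<And>n. n \<ge> M \<Longrightarrow> harm n / real n < 2 * (1 - p)"
    by (auto simp: eventually_sequentially)
  define D where "D = a * ?H M"
  have "a * ?H n - D \<le> row_value p n" for n
  proof (induction n rule: less_induct)
    case (less n)
    show ?case
    proof (cases "n \<le> M")
      case True
      then have "?H n \<le> ?H M" by (intro power_mono harm_mono harm_nonneg)
      then have "a * ?H n - D \<le> 0" using a by (simp add: D_def)
      then show ?thesis using row_value_nonneg[of p n] p by simp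
    next
      case False
      then obtain m where m: "n = Suc m" by (cases n) auto
      let ?L = "a * ?H (Suc m) - D"
      have step: "harm (Suc m) = harm m + 1 / real (Suc m)"
        by (simp add: harm_Suc inverse_eq_divide)
      have "?H (Suc m) - ?H m = (harm (Suc m) + harm m) * (1 / real (Suc m))"
        unfolding power2_eq_square using step by (simp add: algebra_simps)
      also have "\<dots> \<le> (2 * harm (Suc m)) * (1 / real (Suc m))"
        by (intro mult_right_mono) (simp_all add: step field_simps)
      also have "\<dots> \<le> 4 * (1 - p)" using M[of "Suc m"] False m by simp
      finally have "a * (?H (Suc m) - ?H m) \<le> a * (4 * (1 - p))"
        using a by (intro mult_left_mono) auto
      also have "\<dots> = 4 * ((1 - p) * a)" by simp
      also have "\<dots> = 1 / 2" unfolding a(2) by simp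
      finally have "?L - 1 / 2 \<le> a * ?H m - D" by (simp add: algebra_simps)
      also have "\<dots> \<le> row_value p m" using less m by simp
      finally have "p * (?L - 1 / 2) \<le> p * row_value p m" using p by (intro mult_left_mono) auto
      moreover have "p * (1 / 2) \<le> 1 / 2" using p by simp
      ultimately have courteous: "p * ?L - 1 / 2 \<le> p * row_value p m"
        by (simp add: right_diff_distrib)
      have "a * (?H (Suc m) - 4) \<le> a * zipf_mean m ?H"
        using harm_square_minus_zipf_mean(2)[of m] a by (intro mult_left_mono) auto
      then have "?L - 4 * a \<le> a * zipf_mean m ?H - D" by (simp add: algebra_simps)
      also have "\<dots> = zipf_mean m (\<lambda>j. a * ?H j - D)"
        by (simp add: zipf_mean_diff zipf_mean_cmult zipf_mean_const)
      also have "\<dots> \<le> zipf_mean m (row_value p)"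
        by (rule zipf_mean_mono) (use less m in auto)
      finally have "(1 - p) * (?L - 4 * a) \<le> (1 - p) * zipf_mean m (row_value p)"
        using p by (intro mult_left_mono) auto
      moreover have "(1 - p) * (?L - 4 * a) = (1 - p) * ?L - 1 / 2"
        using a(2) by (simp add: right_diff_distrib)
      ultimately have "(1 - p) * ?L - 1 / 2 \<le> (1 - p) * zipf_mean m (row_value p)" by simp
      moreover have "p * ?L + (1 - p) * ?L = ?L" by (simp add: left_diff_distrib)
      ultimately show ?thesis using courteous by (simp add: m)
    qed
  qed
  then show thesis using that[of D] by (simp add: a_def)
qed

text \<open>Since \<open>harm\<close> is unbounded, half of the main term eventually absorbs
  \<open>D\<close>, which turns 1/8 into 1/16. The factor 1/16 is the same for all \<open>p\<close>;
  the threshold may depend on \<open>p\<close> through \<open>D\<close>.\<close>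

lemma eventually_row_value_lower:
  assumes p: "0 \<le> p" "p < 1"
  shows "\<forall>\<^sub>F n in sequentially. 1 / 16 * ((harm n)\<^sup>2 / (1 - p)) \<le> row_value p n"
proof -
  obtain D where D: "\<And>n. (harm n)\<^sup>2 / (8 * (1 - p)) - D \<le> row_value p n"
    using row_value_lower[OF p] by blast
  have "filterlim (\<lambda>n. harm n :: real) at_top sequentially" by (rule harm_at_top)
  \<comment> \<open>The bound 1 makes \<open>harm n\<close> at most its square, so a linear lower
    bound on \<open>harm n\<close> suffices.\<close>
  then have "\<forall>\<^sub>F n in sequentially. max 1 (16 * (1 - p) * D) \<le> (harm n :: real)"
    unfolding filterlim_at_top by blast
  then show ?thesis
  proof eventually_elim
    case (elim n)
    then have "harm n * 1 \<le> (harm n :: real) * harm n" by (intro mult_left_mono) auto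
    with elim have "16 * (1 - p) * D \<le> (harm n)\<^sup>2" by (simp add: power2_eq_square)
    define x where "x = (harm n)\<^sup>2 / (1 - p)"
    have "D \<le> x / 16" using \<open>16 * (1 - p) * D \<le> (harm n)\<^sup>2\<close> p by (simp add: x_def field_simps)
    moreover have "x / 8 - D \<le> row_value p n"
      using D[of n] by (simp add: x_def mult.commute)
    ultimately have "1 / 16 * x \<le> row_value p n" by linarith
    then show ?case unfolding x_def .
  qed
qed

text \<open>For a fixed \<open>p\<close>, Landau classes do not see the factors depending on
  \<open>p\<close>. The second conjunct therefore asks for constants \<open>c\<close> and
  \<open>C\<close> common to all \<open>p\<close>, with only the threshold for \<open>n\<close>
  depending on \<open>p\<close>.\<close>

theorem theorem10:
  "(\<forall>p::real. 0 \<le> p \<and> p < 1 \<longrightarrow>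
      (\<lambda>n. expected_occupied n p) \<in> \<Omega>(\<lambda>n. (harm n)\<^sup>2 / (1 - 0.944 * p)) \<and>
      (\<lambda>n. expected_occupied n p) \<in> O(\<lambda>n. (harm n)\<^sup>2 / (1 - p))) \<and>
   (\<exists>c>0. \<exists>C>0. \<forall>p::real. 0 \<le> p \<and> p < 1 \<longrightarrow>
      (\<forall>\<^sub>F n in sequentially.
         c * ((harm n)\<^sup>2 / (1 - 0.944 * p)) \<le> expected_occupied n p \<and>
         expected_occupied n p \<le> C * ((harm n)\<^sup>2 / (1 - p))))"
proof -
  have ev: "\<forall>\<^sub>F n in sequentially.
      1 / 16 * ((harm n)\<^sup>2 / (1 - 0.944 * p)) \<le> expected_occupied n p \<and>
      expected_occupied n p \<le> 1 * ((harm n)\<^sup>2 / (1 - p))" if p: "0 \<le> p" "p < 1" for p :: real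
    using eventually_row_value_lower[OF p]
  proof eventually_elim
    case (elim n)
    \<comment> \<open>As \<open>0.944 * p \<le> p\<close>, the denominator \<open>1 - p\<close> is
      the smaller one, and the lower bound already proved implies this one.\<close>
    have "(harm n)\<^sup>2 / (1 - 0.944 * p) \<le> (harm n)\<^sup>2 / (1 - p)"
      using p by (intro divide_left_mono) auto
    then have "1 / 16 * ((harm n)\<^sup>2 / (1 - 0.944 * p)) \<le> row_value p n"
      using elim by linarith
    then show ?case
      using row_value_upper[OF p, of n] expected_occupied_eq_row_value[of p n] p by (simp del: times_divide_eq_right)
  qed
  have "(\<lambda>n. expected_occupied n p) \<in> \<Omega>(\<lambda>n. (harm n)\<^sup>2 / (1 - 0.944 * p))"
    "(\<lambda>n. expected_occupied n p) \<in> O(\<lambda>n. (harm n)\<^sup>2 / (1 - p))" if p: "0 \<le> p" "p < 1" for p :: real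
  proof -
    have nonneg: "0 \<le> expected_occupied n p" for n
      using p row_value_nonneg[of p n] by (simp add: expected_occupied_eq_row_value)
    show "(\<lambda>n. expected_occupied n p) \<in> \<Omega>(\<lambda>n. (harm n)\<^sup>2 / (1 - 0.944 * p))"
      by (rule landau_omega.bigI[of "1 / 16"], simp, rule eventually_mono[OF ev[OF p]])
        (use p nonneg in simp)
    show "(\<lambda>n. expected_occupied n p) \<in> O(\<lambda>n. (harm n)\<^sup>2 / (1 - p))"
      by (rule landau_o.bigI[of 1], simp, rule eventually_mono[OF ev[OF p]])
        (use p nonneg in simp)
  qed
  moreover have "\<exists>c>0. \<exists>C>0. \<forall>p::real. 0 \<le> p \<and> p < 1 \<longrightarrow>
      (\<forall>\<^sub>F n in sequentially.
         c * ((harm n)\<^sup>2 / (1 - 0.944 * p)) \<le> expected_occupied n p \<and>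
         expected_occupied n p \<le> C * ((harm n)\<^sup>2 / (1 - p)))"
    using ev by (intro exI[of _ "1 / 16 :: real"] exI[of _ "1 :: real"] conjI allI impI) auto
  ultimately show ?thesis by blast
qed

end
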